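(* For every finite simple undirected graph $G$ and every set $S\subseteq V(G)$, \[ \tau_S(G)\leq \nu_S(G). \]
   Context: Graphs are finite, simple and undirected. For a collection $\mathcal{C}$ of cycles, $V(\mathcal{C}):=\bigcup_{C\in\mathcal{C}}V(C)$. A cycle packing in $G$ is a (possibly empty) collection of pairwise vertex-disjoint cycles of $G$. For $S\subseteq V(G)$, an $S$-cycle is a cycle $C$ of $G$ with $V(C)\cap S\neq\varnothing$. An $S$-cycle transversal is a set $X\subseteq V(G)$ with $X\cap V(C)\neq\varnothing$ for every $S$-cycle $C$ (the set $X$ need not be contained in $S$). $\nu_S(G)$ is the maximum of $|S\cap V(\mathcal{C})|$ over all cycle packings $\mathcal{C}$ in $G$, i.e. the maximum number of vertices of $S$ covered by pairwise vertex-disjoint cycles. $\tau_S(G)$ is the minimum cardinality of an $S$-cycle transversal. Both parameters are $0$ when $G$ has no $S$-cycle. *)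

theory Defs
  imports "Graph_Theory.Pair_Digraph"
begin

text \<open>
  A finite simple undirected graph is a \<open>pair_graph\<close>: a finite vertex set together with a
  symmetric irreflexive arc relation, an edge \<open>uv\<close> being the pair of arcs \<open>(u, v)\<close>, \<open>(v, u)\<close>.
  The library's \<open>cycle\<close> is the directed notion, which admits the closed walk \<open>u, v, u\<close> along a
  single edge; in a simple graph, requiring length at least 3 excludes exactly those walks.
  A cycle of the graph is thus represented by a list of arcs going once around it.
\<close>

definition ugraph_cycle :: "'a pair_pre_digraph \<Rightarrow> ('a \<times> 'a) awalk \<Rightarrow> bool" where
  "ugraph_cycle G C \<longleftrightarrow> pre_digraph.cycle (with_proj G) C \<and> 3 \<le> length C"

definition cycle_verts :: "('a \<times> 'a) awalk \<Rightarrow> 'a set" where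
  "cycle_verts C = Field (set C)"

text \<open>
  Different starting points and orientations of one cycle give different arc lists, but these
  have the same nonempty vertex set, so a packing contains at most one of them.
\<close>

definition cycle_packing :: "'a pair_pre_digraph \<Rightarrow> ('a \<times> 'a) awalk set \<Rightarrow> bool" where
  "cycle_packing G \<C> \<longleftrightarrow>
     (\<forall>C\<in>\<C>. ugraph_cycle G C) \<and> pairwise (\<lambda>C D. disjnt (cycle_verts C) (cycle_verts D)) \<C>"

definition S_cycle :: "'a pair_pre_digraph \<Rightarrow> 'a set \<Rightarrow> ('a \<times> 'a) awalk \<Rightarrow> bool" where
  "S_cycle G S C \<longleftrightarrow> ugraph_cycle G C \<and> cycle_verts C \<inter> S \<noteq> {}"

definition S_cycle_transversal :: "'a pair_pre_digraph \<Rightarrow> 'a set \<Rightarrow> 'a set \<Rightarrow> bool" where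
  "S_cycle_transversal G S X \<longleftrightarrow>
     X \<subseteq> pverts G \<and> (\<forall>C. S_cycle G S C \<longrightarrow> X \<inter> cycle_verts C \<noteq> {})"

definition nu :: "'a pair_pre_digraph \<Rightarrow> 'a set \<Rightarrow> nat" where
  "nu G S = Max {card (S \<inter> (\<Union>C\<in>\<C>. cycle_verts C)) | \<C>. cycle_packing G \<C>}"

definition tau :: "'a pair_pre_digraph \<Rightarrow> 'a set \<Rightarrow> nat" where
  "tau G S = Min {card X | X. S_cycle_transversal G S X}"

text \<open>
  The maximum and the minimum range over finite nonempty sets of natural numbers, hence are
  attained.
\<close>

lemma nu_set_finite_nonempty:
  assumes "pair_graph G" "S \<subseteq> pverts G"
  shows "finite {card (S \<inter> (\<Union>C\<in>\<C>. cycle_verts C)) | \<C>. cycle_packing G \<C>}"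
    and "{card (S \<inter> (\<Union>C\<in>\<C>. cycle_verts C)) | \<C>. cycle_packing G \<C>} \<noteq> {}"
proof -
  interpret pair_graph G by fact
  have "finite S" using assms(2) pair_finite_verts by (rule finite_subset)
  then have "{card (S \<inter> (\<Union>C\<in>\<C>. cycle_verts C)) | \<C>. cycle_packing G \<C>} \<subseteq> {..card S}"
    by (auto intro: card_mono)
  then show "finite {card (S \<inter> (\<Union>C\<in>\<C>. cycle_verts C)) | \<C>. cycle_packing G \<C>}"
    by (rule finite_subset) simp
  have "cycle_packing G {}" by (simp add: cycle_packing_def)
  then show "{card (S \<inter> (\<Union>C\<in>\<C>. cycle_verts C)) | \<C>. cycle_packing G \<C>} \<noteq> {}" by blast
qed

lemma cycle_verts_subset:
  assumes "pair_graph G" "ugraph_cycle G C"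
  shows "cycle_verts C \<subseteq> pverts G"
proof -
  interpret pair_graph G by fact
  have "set C \<subseteq> parcs G"
    using assms(2) unfolding ugraph_cycle_def cycle_def awalk_def by auto
  then show ?thesis
    unfolding cycle_verts_def Field_def by (auto dest: in_arcsD1 in_arcsD2)
qed

lemma tau_set_finite_nonempty:
  assumes "pair_graph G"
  shows "finite {card X | X. S_cycle_transversal G S X}"
    and "{card X | X. S_cycle_transversal G S X} \<noteq> {}"
proof -
  interpret pair_graph G by fact
  have "{card X | X. S_cycle_transversal G S X} \<subseteq> {..card (pverts G)}"
    by (auto simp: S_cycle_transversal_def intro: card_mono)
  then show "finite {card X | X. S_cycle_transversal G S X}"
    by (rule finite_subset) simp
  have "S_cycle_transversal G S (pverts G)"
    unfolding S_cycle_transversal_def S_cycle_def using cycle_verts_subset[OF assms] by blast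
  then show "{card X | X. S_cycle_transversal G S X} \<noteq> {}" by blast
qed

end

theory Submission
  imports Defs
begin

text \<open>
  Allow some vertices to be free: consider edge sets in which every degree is even and the degree
  is at most 2 at each vertex of a set \<open>U \<supseteq> S\<close>, and let \<open>k\<close> be the maximum number of vertices of
  \<open>S\<close> that such an edge set can cover. By induction on \<open>card U\<close>, some \<open>X \<subseteq> U\<close> with
  \<open>card X \<le> k\<close> meets all \<open>S\<close>-cycles. Pick \<open>u \<in> U\<close>, outside \<open>S\<close> unless \<open>U = S\<close>. If every
  optimal edge set uses \<open>u\<close>, delete \<open>u\<close>: then \<open>k\<close> drops and \<open>u\<close> joins \<open>X\<close>. If some optimal
  \<open>M\<close> avoids \<open>u\<close>, remove \<open>u\<close> from \<open>U\<close> and \<open>S\<close>. This does not increase \<open>k\<close>: given \<open>J\<close> with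
  large degree at \<open>u\<close>, the symmetric difference of \<open>M\<close> and \<open>J\<close> contains a closed alternating
  trail \<open>D\<close> that passes through \<open>u\<close> only once, and exchanging along \<open>D\<close> keeps both \<open>M\<close> and \<open>J\<close>
  admissible and preserves the sum of their values, so optimality of \<open>M\<close> makes the new \<open>J\<close> at
  least as good. Finally, if \<open>u \<in> S = U\<close>, no cycle \<open>C\<close> meets \<open>S\<close> in \<open>u\<close> alone, since the
  symmetric difference of \<open>M\<close> and \<open>C\<close> would be better than \<open>M\<close>.
\<close>

section \<open>Exchange along alternating trails\<close>

definition edeg :: "'a set set \<Rightarrow> 'a \<Rightarrow> nat" where
  "edeg F v = card {e \<in> F. v \<in> e}"

lemma edeg_empty [simp]: "edeg {} v = 0"
  by (simp add: edeg_def)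

lemma edeg_Un_disjoint:
  assumes "finite F" "finite F'" "F \<inter> F' = {}"
  shows "edeg (F \<union> F') v = edeg F v + edeg F' v"
proof -
  have "{e \<in> F \<union> F'. v \<in> e} = {e \<in> F. v \<in> e} \<union> {e \<in> F'. v \<in> e}" by auto
  then show ?thesis
    unfolding edeg_def using assms by (simp add: card_Un_disjoint disjoint_iff)
qed

lemma edeg_insert:
  assumes "finite F" "e \<notin> F"
  shows "edeg (insert e F) v = edeg F v + (if v \<in> e then 1 else 0)"
proof -
  have "{f \<in> insert e F. v \<in> f} = (if v \<in> e then insert e {f \<in> F. v \<in> f} else {f \<in> F. v \<in> f})"
    by auto
  then show ?thesis
    unfolding edeg_def using assms by simp
qed

lemma edeg_mono: "finite F' \<Longrightarrow> F \<subseteq> F' \<Longrightarrow> edeg F v \<le> edeg F' v"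
  unfolding edeg_def by (rule card_mono) auto

lemma edeg_eq_0_iff: "finite F \<Longrightarrow> edeg F v = 0 \<longleftrightarrow> (\<forall>e\<in>F. v \<notin> e)"
  by (auto simp: edeg_def)

lemma edeg_diff_Int:
  assumes "finite F"
  shows "edeg F v = edeg (F - D) v + edeg (F \<inter> D) v"
proof -
  have "F = (F - D) \<union> (F \<inter> D)" by auto
  moreover have "(F - D) \<inter> (F \<inter> D) = {}" by auto
  ultimately show ?thesis
    using edeg_Un_disjoint[of "F - D" "F \<inter> D" v] assms by (simp add: finite_Diff)
qed

lemma edeg_sym_diff:
  assumes "finite F" "finite D"
  shows "edeg (sym_diff F D) v + 2 * edeg (F \<inter> D) v = edeg F v + edeg D v"
proof -
  have "edeg (sym_diff F D) v = edeg (F - D) v + edeg (D - F) v"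
    using assms by (intro edeg_Un_disjoint) auto
  then show ?thesis
    using edeg_diff_Int[OF assms(1), of v D] edeg_diff_Int[OF assms(2), of v F]
    by (simp add: Int_commute)
qed

lemma ex_edge_if_edeg_less:
  assumes "finite F" "edeg F v < edeg F' v"
  shows "\<exists>e \<in> F' - F. v \<in> e"
proof (rule ccontr)
  assume "\<not> ?thesis"
  then have "{e \<in> F'. v \<in> e} \<subseteq> {e \<in> F. v \<in> e}" by auto
  then have "edeg F' v \<le> edeg F v"
    unfolding edeg_def using assms(1) by (intro card_mono) auto
  with assms(2) show False by simp
qed

text \<open>
  The trail is grown as a mere edge set \<open>P\<close> leading from \<open>u\<close> to a current endpoint \<open>x\<close>; counting
  unused edges at \<open>x\<close> shows that it can be extended until it returns to \<open>u\<close> for the first time.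
\<close>

lemma closed_alternating_trail:
  assumes fin: "finite A" "finite B" and disj: "A \<inter> B = {}"
    and edges: "\<And>e. e \<in> A \<union> B \<Longrightarrow> card e = 2"
    and even: "\<And>v. even (edeg A v + edeg B v)"
    and u: "edeg A u = 0" "edeg B u > 0"
  shows "\<exists>D \<subseteq> A \<union> B. edeg D u = 2 \<and> (\<forall>v. even (edeg D v)) \<and>
    (\<forall>v. v \<noteq> u \<longrightarrow> edeg A v = edeg B v \<longrightarrow> edeg (D \<inter> A) v = edeg (D \<inter> B) v)"
proof -
  \<comment> \<open>Alternation is demanded only where \<open>A\<close> and \<open>B\<close> have
    equal degree; the exchange tolerates an imbalance elsewhere, as long as degrees stay
    even.\<close>
  define balanced where "balanced D v \<longleftrightarrow>
    even (edeg D v) \<and> (edeg A v = edeg B v \<longrightarrow> edeg (D \<inter> A) v = edeg (D \<inter> B) v)" for D v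
  \<comment> \<open>The invariant of an unfinished trail: at its end \<open>x\<close> one edge still
    lacks a partner, so where the degrees agree one of the two types is ahead by one.\<close>
  define open_at where "open_at P x \<longleftrightarrow> P \<subseteq> A \<union> B \<and> x \<noteq> u \<and> edeg P u = 1 \<and> odd (edeg P x) \<and>
    (edeg A x = edeg B x \<longrightarrow> edeg (P \<inter> A) x = Suc (edeg (P \<inter> B) x) \<or> edeg (P \<inter> B) x = Suc (edeg (P \<inter> A) x)) \<and>
    (\<forall>v. v \<noteq> u \<longrightarrow> v \<noteq> x \<longrightarrow> balanced P v)" for P x
  have insA: "edeg (insert f P \<inter> A) v = edeg (P \<inter> A) v + (if v \<in> f \<and> f \<in> A then 1 else 0)"
    and insB: "edeg (insert f P \<inter> B) v = edeg (P \<inter> B) v + (if v \<in> f \<and> f \<in> B then 1 else 0)"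
    if "f \<notin> P" for f P v
    using that fin by (auto simp: Int_insert_left edeg_insert)
  have main: "\<exists>D \<subseteq> A \<union> B. edeg D u = 2 \<and> (\<forall>v. v \<noteq> u \<longrightarrow> balanced D v)" if "open_at P x" for P x
    using that
  proof (induction "card (A \<union> B - P)" arbitrary: P x rule: less_induct)
    case less
    have P: "P \<subseteq> A \<union> B" "x \<noteq> u" "edeg P u = 1" "odd (edeg P x)"
      and Px: "edeg A x = edeg B x \<Longrightarrow>
        edeg (P \<inter> A) x = Suc (edeg (P \<inter> B) x) \<or> edeg (P \<inter> B) x = Suc (edeg (P \<inter> A) x)"
      and Pv: "\<And>v. v \<noteq> u \<Longrightarrow> v \<noteq> x \<Longrightarrow> balanced P v"
      using less.prems by (auto simp: open_at_def)
    have finP: "finite P" using P(1) fin finite_subset by blast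
    have leA: "edeg (P \<inter> A) x \<le> edeg A x" and leB: "edeg (P \<inter> B) x \<le> edeg B x"
      using fin by (auto intro: edeg_mono)
    \<comment> \<open>The next edge: with equal degrees, the type that is one behind in
      \<open>P\<close> is strictly below its full degree at \<open>x\<close>; with unequal ones,
      \<open>edeg P x\<close> is odd while the total is even. Either way an edge at \<open>x\<close>
      is left over.\<close>
    have "\<exists>f \<in> A \<union> B - P. x \<in> f \<and> (edeg A x = edeg B x \<longrightarrow>
        edeg (insert f P \<inter> A) x = edeg (insert f P \<inter> B) x)"
    proof (cases "edeg A x = edeg B x")
      case True
      from Px[OF this] show ?thesis
      proof
        assume *: "edeg (P \<inter> A) x = Suc (edeg (P \<inter> B) x)"
        then have "edeg (P \<inter> B) x < edeg B x" using leA True by simp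
        from ex_edge_if_edeg_less[OF _ this] finP obtain f where f: "f \<in> B" "f \<notin> P" "x \<in> f" by auto
        with * disj show ?thesis by (intro bexI[of _ f])
            (auto simp: insA insB simp del: Int_insert_left_if0 Int_insert_left_if1)
      next
        assume *: "edeg (P \<inter> B) x = Suc (edeg (P \<inter> A) x)"
        then have "edeg (P \<inter> A) x < edeg A x" using leB True by simp
        from ex_edge_if_edeg_less[OF _ this] finP obtain f where f: "f \<in> A" "f \<notin> P" "x \<in> f" by auto
        with * disj show ?thesis by (intro bexI[of _ f])
            (auto simp: insA insB simp del: Int_insert_left_if0 Int_insert_left_if1)
      qed
    next
      case False
      have "edeg (A \<union> B) x = edeg A x + edeg B x" by (rule edeg_Un_disjoint[OF fin disj])
      then have "edeg P x \<noteq> edeg (A \<union> B) x" using P(4) even[of x] by metis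
      moreover have "edeg P x \<le> edeg (A \<union> B) x" using fin P(1) by (auto intro: edeg_mono)
      ultimately have "edeg P x < edeg (A \<union> B) x" by simp
      from ex_edge_if_edeg_less[OF finP this] False show ?thesis by auto
    qed
    then obtain f where f: "f \<in> A \<union> B" "f \<notin> P" "x \<in> f"
      and fx: "edeg A x = edeg B x \<Longrightarrow> edeg (insert f P \<inter> A) x = edeg (insert f P \<inter> B) x"
      by auto
    obtain y where y: "f = {x, y}" "y \<noteq> x"
      using edges[OF f(1)] f(3) by (auto simp: card_2_iff doubleton_eq_iff)
    let ?P = "insert f P"
    have sub: "?P \<subseteq> A \<union> B" using P(1) f(1) by auto
    have deg: "edeg ?P v = edeg P v + (if v \<in> f then 1 else 0)" for v
      by (rule edeg_insert[OF finP f(2)])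
    have bal: "balanced ?P v" if "v \<noteq> u" "v \<noteq> y" for v
    proof (cases "v = x")
      case True
      then show ?thesis using deg[of x] P(4) f(3) fx by (auto simp: balanced_def)
    next
      case False
      then show ?thesis
        using Pv[OF that(1) False] that y deg[of v] f(2)
          by (auto simp: balanced_def insA insB simp del: Int_insert_left_if0 Int_insert_left_if1)
    qed
    show ?case
    \<comment> \<open>Back at \<open>u\<close>, which had degree 1 in \<open>P\<close>, the trail
      closes with degree exactly 2; otherwise \<open>y\<close> becomes the new open end.\<close>
    proof (cases "y = u")
      case True
      then show ?thesis using sub deg[of u] y P(3) bal by (intro exI[of _ ?P]) auto
    next
      case False
      have "balanced P y" using Pv False y(2) by auto
      then have "open_at ?P y"
        using sub False deg[of u] deg[of y] y P(2,3) f(1,2) bal disj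
        by (auto simp: open_at_def balanced_def insA insB simp del: Int_insert_left_if0 Int_insert_left_if1)
      moreover have "card (A \<union> B - ?P) < card (A \<union> B - P)"
        using fin f by (intro psubset_card_mono) auto
      ultimately show ?thesis using less.hyps by blast
    qed
  qed
  \<comment> \<open>The trail has to leave \<open>u\<close> along an edge of \<open>B\<close>, since
    \<open>A\<close> has none there.\<close>
  obtain e where e: "e \<in> B" "u \<in> e"
    using u fin by (metis edeg_eq_0_iff less_nat_zero_code)
  obtain y where y: "e = {u, y}" "y \<noteq> u"
    using edges[of e] e by (auto simp: card_2_iff doubleton_eq_iff)
  have "e \<notin> A" using e disj by auto
  then have "open_at {e} y"
    using e y edeg_insert[of "{}" e] by (auto simp: open_at_def balanced_def)
  from main[OF this] obtain D where D: "D \<subseteq> A \<union> B" "edeg D u = 2"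
    "\<And>v. v \<noteq> u \<Longrightarrow> balanced D v" by auto
  then have "even (edeg D v)" for v by (cases "v = u") (auto simp: balanced_def)
  with D show ?thesis unfolding balanced_def by (intro exI[of _ D]) auto
qed

section \<open>Even edge sets with degree capacities, and the exchange between two of them\<close>

definition even_subgraph :: "'a set \<Rightarrow> 'a set set \<Rightarrow> bool" where
  "even_subgraph U F \<longleftrightarrow> (\<forall>v. even (edeg F v)) \<and> (\<forall>v\<in>U. edeg F v \<le> 2)"

lemma even_le_2: "even (n::nat) \<Longrightarrow> n \<le> 2 \<Longrightarrow> n = 0 \<or> n = 2"
  by presburger

text \<open>
  The value of an edge set is measured by a degree sum over \<open>S\<close>, i.e. by twice the number of
  covered vertices of \<open>S\<close>.
\<close>

lemma free_avoidable_vertex: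
  assumes fin: "finite E" and edges: "\<And>e. e \<in> E \<Longrightarrow> card e = 2"
    and bound: "\<And>F. F \<subseteq> E \<Longrightarrow> even_subgraph U F \<Longrightarrow> sum (edeg F) S \<le> k"
    and M: "M \<subseteq> E" "even_subgraph U M" "sum (edeg M) S = k" "edeg M u = 0"
    and finS: "finite S"
  assumes "J \<subseteq> E" "even_subgraph (U - {u}) J"
  shows "sum (edeg J) (S - {u}) \<le> k"
  using assms(9,10)
\<comment> \<open>Each exchange moves \<open>J\<close> closer to \<open>M\<close>: the edges of
  \<open>D\<close> leave the symmetric difference.\<close>
proof (induction "card (sym_diff M J)" arbitrary: J rule: less_induct)
  case less
  note J = less.prems
  have finM: "finite M" and finJ: "finite J" using M(1) J(1) fin finite_subset by auto
  have restrict: "sum (edeg F) (S - {u}) \<le> sum (edeg F) S" for F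
    using finS by (intro sum_mono2) auto
  show ?case
  proof (cases "edeg J u \<le> 2")
    case True
    then have "even_subgraph U J" using J(2) by (auto simp: even_subgraph_def)
    then show ?thesis using bound[OF J(1)] restrict[of J] by simp
  next
    case False
    define A B where "A = M - J" and "B = J - M"
    have AB: "finite A" "finite B" "A \<inter> B = {}" "A \<union> B = sym_diff M J"
      using finM finJ by (auto simp: A_def B_def)
    have degM: "edeg M v = edeg A v + edeg (M \<inter> J) v" and degJ: "edeg J v = edeg B v + edeg (M \<inter> J) v" for v
      using edeg_diff_Int[OF finM, of v J] edeg_diff_Int[OF finJ, of v M]
      by (auto simp: A_def B_def Int_commute)
    have ev: "even (edeg M v)" "even (edeg J v)" for v
      using M(2) J(2) by (auto simp: even_subgraph_def)
    have "even (edeg A v + edeg B v)" for v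
      using ev[of v] degM[of v] degJ[of v] by presburger
    moreover have "card e = 2" if "e \<in> A \<union> B" for e
      using that edges M(1) J(1) by (auto simp: A_def B_def)
    moreover have "edeg A u = 0" "edeg B u > 0"
      using M(4) False degM[of u] degJ[of u] by auto
    ultimately obtain D where D: "D \<subseteq> A \<union> B" "edeg D u = 2" "\<And>v. even (edeg D v)"
      "\<And>v. v \<noteq> u \<Longrightarrow> edeg A v = edeg B v \<Longrightarrow> edeg (D \<inter> A) v = edeg (D \<inter> B) v"
      using closed_alternating_trail[OF AB(1-3)] by metis
    have finD: "finite D" using D(1) AB(1,2) finite_subset by blast
    have MD: "M \<inter> D = D \<inter> A" and JD: "J \<inter> D = D \<inter> B" using D(1) by (auto simp: A_def B_def)
    have "D = (D \<inter> A) \<union> (D \<inter> B)" using D(1) by auto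
    then have degD: "edeg D v = edeg (D \<inter> A) v + edeg (D \<inter> B) v" for v
      using edeg_Un_disjoint[of "D \<inter> A" "D \<inter> B" v] finD AB(3) by fastforce
    define M' J' where "M' = sym_diff M D" and "J' = sym_diff J D"
    have degM': "edeg M' v + 2 * edeg (D \<inter> A) v = edeg M v + edeg D v"
      and degJ': "edeg J' v + 2 * edeg (D \<inter> B) v = edeg J v + edeg D v" for v
      using edeg_sym_diff[OF finM finD, of v] edeg_sym_diff[OF finJ finD, of v]
      by (simp_all only: M'_def J'_def MD JD)
    \<comment> \<open>An edge of \<open>D\<close> lies in exactly one of \<open>M\<close> and
      \<open>J\<close> and moves to the other one.\<close>
    have total: "edeg M' v + edeg J' v = edeg M v + edeg J v" for v
      using degM'[of v] degJ'[of v] degD[of v] by simp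
    have ev': "even (edeg M' v)" "even (edeg J' v)" for v
      using degM'[of v] degJ'[of v] ev[of v] D(3)[of v] by presburger+
    have le2: "edeg M' v \<le> 2 \<and> edeg J' v \<le> 2" if "v \<in> U" "v \<noteq> u" for v
    proof -
      have M2: "edeg M v = 0 \<or> edeg M v = 2" and J2: "edeg J v = 0 \<or> edeg J v = 2"
        using M(2) J(2) that even_le_2[of "edeg M v"] even_le_2[of "edeg J v"]
        by (auto simp: even_subgraph_def)
      show ?thesis
      \<comment> \<open>Equal degrees are preserved because \<open>D\<close> alternates at
        \<open>v\<close>. Unequal ones are 0 and 2, and their unchanged sum bounds both new
        degrees.\<close>
      proof (cases "edeg M v = edeg J v")
        case True
        then have "edeg (D \<inter> A) v = edeg (D \<inter> B) v"
          using D(4)[OF that(2)] degM[of v] degJ[of v] by simp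
        then show ?thesis using degM'[of v] degJ'[of v] degD[of v] M2 J2 by auto
      next
        case False
        then show ?thesis using total[of v] M2 J2 by auto
      qed
    qed
    \<comment> \<open>Here it matters that \<open>D\<close> passes \<open>u\<close> only once:
      \<open>M'\<close> gets degree 2 there and respects all of \<open>U\<close>, so
      \<open>bound\<close> applies to it, while \<open>J'\<close> is controlled only off
      \<open>u\<close>.\<close>
    have "edeg M' u \<le> 2" using degM'[of u] M(4) D(2) by simp
    with le2 ev' have "even_subgraph U M'" and J'ok: "even_subgraph (U - {u}) J'"
      unfolding even_subgraph_def by auto
    moreover have "M' \<subseteq> E" and J'E: "J' \<subseteq> E"
      using M(1) J(1) D(1) by (auto simp: M'_def J'_def A_def B_def)
    ultimately have "sum (edeg M') S \<le> k" using bound by blast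
    then have 1: "sum (edeg M') (S - {u}) \<le> k" using restrict[of M'] by simp
    have "D \<noteq> {}" using D(2) by auto
    moreover have "sym_diff M J' = sym_diff M J - D"
      using D(1) by (auto simp: J'_def A_def B_def)
    ultimately have "sym_diff M J' \<subset> sym_diff M J" using D(1) by (auto simp: A_def B_def)
    then have "card (sym_diff M J') < card (sym_diff M J)"
      using finM finJ by (intro psubset_card_mono) auto
    from less.hyps[OF this J'E J'ok] have 2: "sum (edeg J') (S - {u}) \<le> k" .
    \<comment> \<open>\<open>M\<close> attains \<open>k\<close> off \<open>u\<close>, and neither
      \<open>M'\<close> nor \<open>J'\<close> exceeds it there; as the two sums of values agree,
      \<open>J\<close> cannot exceed it either.\<close>
    have "sum (edeg M) (S - {u}) = k"
      using M(3,4) finS by (metis sum_diff1_nat diff_zero)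
    moreover have "sum (edeg M') (S - {u}) + sum (edeg J') (S - {u})
        = sum (edeg M) (S - {u}) + sum (edeg J) (S - {u})"
      by (simp add: sum.distrib[symmetric] total)
    ultimately show ?thesis using 1 2 by linarith
  qed
qed

text \<open>
  With \<open>UNIV\<close> as the set of capacitated vertices, \<open>C\<close> ranges over disjoint unions of cycles.
\<close>

lemma transversal_of_bounded_even_subgraphs:
  assumes "finite E" "\<And>e. e \<in> E \<Longrightarrow> card e = 2" "finite U" "S \<subseteq> U"
    and "\<And>F. F \<subseteq> E \<Longrightarrow> even_subgraph U F \<Longrightarrow> sum (edeg F) S \<le> 2 * k"
  shows "\<exists>X \<subseteq> U. card X \<le> k \<and>
    (\<forall>C \<subseteq> E. even_subgraph UNIV C \<longrightarrow> (\<forall>x\<in>X. edeg C x = 0) \<longrightarrow> (\<forall>s\<in>S. edeg C s = 0))"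
  using assms
proof (induction "card U" arbitrary: E U S k rule: less_induct)
  case less
  note fin = less.prems(1) and edges = less.prems(2) and finU = less.prems(3)
    and SU = less.prems(4) and bound = less.prems(5)
  have finS: "finite S" using SU finU finite_subset by auto
  show ?case
  proof (cases "U = {}")
    case True
    then show ?thesis using SU by (intro exI[of _ "{}"]) auto
  next
    case False
    \<comment> \<open>When \<open>u\<close> is in \<open>S\<close>, having \<open>U = S\<close>
      means that knowing the degrees on \<open>S\<close> is enough to check all capacities of the
      symmetric difference \<open>F\<close> below.\<close>
    then obtain u where u: "u \<in> U" "u \<in> S \<Longrightarrow> U = S" using SU by blast
    have card: "card (U - {u}) < card U" using finU u(1) by (rule card_Diff1_less)
    have finU': "finite (U - {u})" and SU': "S - {u} \<subseteq> U - {u}" using finU SU by auto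
    show ?thesis
    proof (cases "\<exists>M \<subseteq> E. even_subgraph U M \<and> sum (edeg M) S = 2 * k \<and> edeg M u = 0")
      case False
      define E' where "E' = {e \<in> E. u \<notin> e}"
      \<comment> \<open>For \<open>k = 0\<close> the empty edge set would be an optimum avoiding
        \<open>u\<close>.\<close>
      have k: "k > 0"
      proof (rule ccontr)
        assume "\<not> k > 0"
        then show False using False by (auto simp: even_subgraph_def dest!: spec[of _ "{}"])
      qed
      have "sum (edeg F) (S - {u}) \<le> 2 * (k - 1)" if F: "F \<subseteq> E'" "even_subgraph (U - {u}) F" for F
      proof -
        have F0: "edeg F u = 0"
          using F(1) fin finite_subset[of F E] by (subst edeg_eq_0_iff) (auto simp: E'_def)
        have FE: "F \<subseteq> E" and ok: "even_subgraph U F"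
          using F F0 by (auto simp: E'_def even_subgraph_def)
        \<comment> \<open>\<open>F\<close> avoids \<open>u\<close>, so attaining
          \<open>2 * k\<close> would contradict the case assumption; as a sum of even degrees, the
          value then stays at least 2 below.\<close>
        have "sum (edeg F) (S - {u}) \<noteq> 2 * k \<and> sum (edeg F) (S - {u}) \<le> 2 * k"
          using bound[OF FE ok] False FE ok F0 finS by (metis sum_diff1_nat diff_zero)
        moreover have "even (sum (edeg F) (S - {u}))"
          using F(2) by (auto simp: even_subgraph_def intro: dvd_sum)
        ultimately show ?thesis by (auto elim!: evenE)
      qed
      from less.hyps[OF card _ _ finU' SU' this, of E'] fin edges
      obtain X where X: "X \<subseteq> U - {u}" "card X \<le> k - 1"
        "\<And>C s. C \<subseteq> E' \<Longrightarrow> even_subgraph UNIV C \<Longrightarrow> (\<forall>x\<in>X. edeg C x = 0) \<Longrightarrow> s \<in> S - {u} \<Longrightarrow> edeg C s = 0"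
        unfolding E'_def by auto
      show ?thesis
      proof (intro exI[of _ "insert u X"] conjI allI impI ballI)
        show "insert u X \<subseteq> U" using X(1) u(1) by auto
        show "card (insert u X) \<le> k"
          using X(1,2) k finite_subset[OF X(1) finU'] by (auto simp: card_insert_if)
        fix C s assume C: "C \<subseteq> E" "even_subgraph UNIV C" "\<forall>x\<in>insert u X. edeg C x = 0" "s \<in> S"
        have "C \<subseteq> E'" using C(1,3) finite_subset[OF C(1) fin] by (auto simp: E'_def edeg_eq_0_iff)
        then show "edeg C s = 0" using X(3)[of C s] C by auto
      qed
    next
      case True
      then obtain M where M: "M \<subseteq> E" "even_subgraph U M" "sum (edeg M) S = 2 * k" "edeg M u = 0"
        by auto
      have finM: "finite M" using M(1) fin finite_subset by auto
      have "sum (edeg J) (S - {u}) \<le> 2 * k" if "J \<subseteq> E" "even_subgraph (U - {u}) J" for J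
        by (rule free_avoidable_vertex[OF fin edges bound M finS that])
      from less.hyps[OF card fin edges finU' SU' this]
      obtain X where X: "X \<subseteq> U - {u}" "card X \<le> k"
        "\<And>C s. C \<subseteq> E \<Longrightarrow> even_subgraph UNIV C \<Longrightarrow> (\<forall>x\<in>X. edeg C x = 0) \<Longrightarrow> s \<in> S - {u} \<Longrightarrow> edeg C s = 0"
        by auto
      have "edeg C s = 0"
        if C: "C \<subseteq> E" "even_subgraph UNIV C" "\<forall>x\<in>X. edeg C x = 0" "s \<in> S" for C s
      proof (cases "s = u")
        case False
        then show ?thesis using X(3)[OF C(1-3)] C(4) by auto
      next
        case True
        have finC: "finite C" using C(1) fin finite_subset by auto
        \<comment> \<open>Since \<open>C\<close> avoids \<open>X\<close>, it misses
          \<open>S - {u}\<close>. Hence its symmetric difference with \<open>M\<close> has the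
          degrees of \<open>M\<close> on \<open>S - {u}\<close> and the degree of \<open>C\<close>
          at \<open>u\<close>.\<close>
        have C0: "edeg C v = 0" if "v \<in> S - {u}" for v by (rule X(3)[OF C(1-3) that])
        define F where "F = sym_diff M C"
        have deg: "edeg F v + 2 * edeg (M \<inter> C) v = edeg M v + edeg C v" for v
          unfolding F_def by (rule edeg_sym_diff[OF finM finC])
        have le: "edeg (M \<inter> C) v \<le> edeg M v" "edeg (M \<inter> C) v \<le> edeg C v" for v
          using finM finC by (auto intro: edeg_mono)
        have degS: "edeg F v = edeg M v" if "v \<in> S - {u}" for v
          using deg[of v] le[of v] C0[OF that] by simp
        have degu: "edeg F u = edeg C u" using deg[of u] le[of u] M(4) by simp
        have "even (edeg F v)" for v
        proof -
          have "even (edeg M v)" "even (edeg C v)" using M(2) C(2) by (auto simp: even_subgraph_def)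
          then show ?thesis using deg[of v] by presburger
        qed
        moreover have "edeg F v \<le> 2" if "v \<in> U" for v
          using that degS[of v] degu u(2) True C(2,4) M(2)
          by (cases "v = u") (auto simp: even_subgraph_def)
        ultimately have "even_subgraph U F" by (simp add: even_subgraph_def)
        moreover have "F \<subseteq> E" using M(1) C(1) by (auto simp: F_def)
        ultimately have "sum (edeg F) S \<le> sum (edeg M) S" using bound M(3) by simp
        moreover have "sum (edeg F) S = edeg C u + sum (edeg M) (S - {u})"
          using finS C(4) True degu degS by (simp add: sum.remove[of S u])
        moreover have "sum (edeg M) S = sum (edeg M) (S - {u})"
          using finS C(4) True M(4) by (simp add: sum.remove[of S u])
        ultimately show ?thesis using True by simp
      qed
      then show ?thesis using X(1,2) by (intro exI[of _ X]) auto
    qed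
  qed
qed

section \<open>Cycles and 2-regular edge sets\<close>

definition edges_of :: "('a \<times> 'a) set \<Rightarrow> 'a set set" where
  "edges_of R = (\<lambda>(a, b). {a, b}) ` R"

lemma pcas_imp_map_snd: "pcas u p v \<Longrightarrow> u # map snd p = map fst p @ [v]"
  by (induction p arbitrary: u) auto

lemma pawalk_verts_eq: "pawalk_verts u p = u # map snd p" if "pcas u p v"
  using that by (induction p arbitrary: u) auto

text \<open>Together with \<open>cycle_zip_rotate1\<close>, this replaces closed walks by vertex
  lists without repetition, \<open>rotate1\<close> giving the cyclic successor.\<close>

lemma cycle_imp_rotate1:
  assumes "pair_graph G" "pre_digraph.cycle (with_proj G) C"
  shows "distinct (map fst C)" "map snd C = rotate1 (map fst C)" "set C \<subseteq> parcs G"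
proof -
  interpret pair_graph G by fact
  obtain u where u: "pcas u C u" "set C \<subseteq> parcs G" "distinct (tl (pawalk_verts u C))" "C \<noteq> []"
    using assms(2) unfolding cycle_def awalk_def by auto
  have "u # map snd C = map fst C @ [u]" by (rule pcas_imp_map_snd[OF u(1)])
  with u(4) show eq: "map snd C = rotate1 (map fst C)" by (cases C) auto
  from u(3) pawalk_verts_eq[OF u(1)] have "distinct (map snd C)" by simp
  with eq show "distinct (map fst C)" by simp
  show "set C \<subseteq> parcs G" by fact
qed

lemma cycle_zip_rotate1:
  assumes "pair_graph G" "distinct ys" "ys \<noteq> []" "set (zip ys (rotate1 ys)) \<subseteq> parcs G"
  shows "pre_digraph.cycle (with_proj G) (zip ys (rotate1 ys))"
proof -
  interpret pair_graph G by fact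
  obtain y zs where ys: "ys = y # zs" using assms(3) by (cases ys) auto
  have cas: "pcas x (zip (x # zs) (zs @ [w])) w" for x w
    by (induction zs arbitrary: x) auto
  have "y \<in> fst ` set (zip ys (rotate1 ys))" using ys by (cases zs) auto
  then have "y \<in> pverts G" using assms(4) by (auto dest: in_arcsD1)
  moreover have "tl (pawalk_verts y (zip ys (rotate1 ys))) = rotate1 ys"
    using pawalk_verts_eq[OF cas[of y y]] by (simp add: ys del: zip_Cons_Cons)
  ultimately show ?thesis
    unfolding cycle_def awalk_def using cas[of y y] assms(2,4) ys by (intro exI[of _ y]) auto
qed

text \<open>As tails are distinct, \<open>(b, a)\<close> could only be the cyclic successor of
  \<open>(a, b)\<close>, and conversely; two positions that succeed each other force length at most
  2.\<close>

lemma no_antiparallel_arcs: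
  assumes dist: "distinct (map fst C)" and rot: "map snd C = rotate1 (map fst C)"
    and len: "3 \<le> length C" and "(a, b) \<in> set C"
  shows "(b, a) \<notin> set C"
proof
  let ?n = "length C"
  have nxt: "snd (C ! i) = fst (C ! (Suc i mod ?n))" if "i < ?n" for i
  proof -
    have "Suc i mod ?n < ?n" using that by (intro mod_less_divisor) linarith
    then show ?thesis
      using that arg_cong[OF rot, of "\<lambda>xs. xs ! i"] by (simp add: nth_rotate1)
  qed
  have inj: "i = j" if "i < ?n" "j < ?n" "fst (C ! i) = fst (C ! j)" for i j
    using dist that by (simp add: distinct_conv_nth) (metis)
  assume "(b, a) \<in> set C"
  then obtain j where j: "j < ?n" "C ! j = (b, a)" by (auto simp: in_set_conv_nth)
  obtain i where i: "i < ?n" "C ! i = (a, b)" using assms(4) by (auto simp: in_set_conv_nth)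
  have pos: "0 < ?n" using len by linarith
  have wrap: "Suc m = ?n \<and> Suc m mod ?n = 0 \<or> Suc m mod ?n = Suc m" if "m < ?n" for m
    using that by (cases "Suc m = ?n") simp_all
  have "j = Suc i mod ?n" using nxt[OF i(1)] i(2) j
    by (intro inj) (simp_all only: fst_conv snd_conv mod_less_divisor[OF pos])
  with wrap[OF i(1)] have ij: "Suc i = ?n \<and> j = 0 \<or> j = Suc i" by metis
  have "i = Suc j mod ?n" using nxt[OF j(1)] j(2) i
    by (intro inj) (simp_all only: fst_conv snd_conv mod_less_divisor[OF pos])
  with wrap[OF j(1)] have "Suc j = ?n \<and> i = 0 \<or> i = Suc j" by metis
  with ij len show False by linarith
qed

lemma card_fibre_inj_on:
  assumes "inj_on f A"
  shows "card {a \<in> A. f a = v} = (if v \<in> f ` A then 1 else 0)"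
proof (cases "v \<in> f ` A")
  case True
  then obtain a where "a \<in> A" "f a = v" by auto
  then have "{a \<in> A. f a = v} = {a}" using assms by (auto dest: inj_onD)
  then show ?thesis using True by simp
next
  case False
  then have "{a \<in> A. f a = v} = {}" by auto
  then show ?thesis using False by (simp only: card.empty if_False)
qed

text \<open>Every vertex of the cycle is the tail of one arc and the head of another; without
  antiparallel arcs, forgetting orientation identifies no two arcs.\<close>

lemma edeg_cycle:
  assumes dist: "distinct (map fst C)" and rot: "map snd C = rotate1 (map fst C)"
    and len: "3 \<le> length C"
  shows "edeg (edges_of (set C)) v = (if v \<in> cycle_verts C then 2 else 0)"
proof -
  have img: "snd ` set C = fst ` set C" using arg_cong[OF rot, of set] by simp
  have verts: "cycle_verts C = fst ` set C"
    using img by (simp add: cycle_verts_def Field_def Domain_fst Range_snd)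
  have anti: "(b, a) \<notin> set C" if "(a, b) \<in> set C" for a b
    by (rule no_antiparallel_arcs[OF dist rot len that])
  let ?O = "{e \<in> set C. fst e = v}" and ?I = "{e \<in> set C. snd e = v}"
  have "inj_on fst (set C)" and "inj_on snd (set C)"
    using dist rot by (metis distinct_map distinct1_rotate)+
  then have le: "card ?O = (if v \<in> fst ` set C then 1 else 0)"
    "card ?I = (if v \<in> snd ` set C then 1 else 0)"
    by (auto simp only: card_fibre_inj_on)
  have "{e \<in> edges_of (set C). v \<in> e} = (\<lambda>(a, b). {a, b}) ` (?O \<union> ?I)"
    by (auto simp: edges_of_def)
  moreover have "inj_on (\<lambda>(a, b). {a, b}) (set C)"
    using anti by (auto simp: inj_on_def doubleton_eq_iff)
  then have "inj_on (\<lambda>(a, b). {a, b}) (?O \<union> ?I)"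
    by (rule inj_on_subset) auto
  moreover have "?O \<inter> ?I = {}" using anti[of v v] by auto
  ultimately show ?thesis
    using le verts img by (simp add: edeg_def card_image card_Un_disjoint)
qed

section \<open>Decomposition of edge sets with all degrees 0 or 2 into cycles\<close>

lemma successively_imp_zip:
  assumes "successively P (y # zs)" "P (last (y # zs)) w" "(a, b) \<in> set (zip (y # zs) (zs @ [w]))"
  shows "P a b"
  using assms
proof (induction zs arbitrary: y)
  case (Cons z zs)
  then show ?case using Cons.IH[of z] by auto
qed simp

text \<open>The first vertex of a longest path has a second edge. By maximality it leads back to the
  path, and it closes an initial segment to a cycle.\<close>

lemma ex_cycle_in_two_regular:
  assumes fin: "finite F" and edges: "\<And>e. e \<in> F \<Longrightarrow> card e = 2"
    and reg: "\<And>v. edeg F v = 0 \<or> edeg F v = 2" and "F \<noteq> {}"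
  shows "\<exists>ys. distinct ys \<and> 3 \<le> length ys \<and> edges_of (set (zip ys (rotate1 ys))) \<subseteq> F"
proof -
  let ?path = "\<lambda>xs. distinct xs \<and> 2 \<le> length xs \<and> successively (\<lambda>a b. {a, b} \<in> F) xs"
  have "finite e" if "e \<in> F" for e using edges[OF that] card.infinite by fastforce
  then have finV: "finite (\<Union>F)" using fin by auto
  have path_verts: "set xs \<subseteq> \<Union>F" if "successively (\<lambda>a b. {a, b} \<in> F) xs" "2 \<le> length xs" for xs
    using that
  proof (induction xs rule: induct_list012)
    case (3 x y zs)
    then show ?case by (cases zs) auto
  qed auto
  have bound: "length xs \<le> card (\<Union>F)" if "?path xs" for xs
    using that path_verts[of xs] finV by (metis card_mono distinct_card)
  obtain e where "e \<in> F" using \<open>F \<noteq> {}\<close> by auto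
  then obtain a b where "{a, b} \<in> F" "a \<noteq> b" using edges by (metis card_2_iff)
  then have "?path [a, b]" by simp
  then have "\<exists>xs. ?path xs \<and> (\<forall>zs. ?path zs \<longrightarrow> length zs \<le> length xs)"
    by (rule ex_has_greatest_nat[where b = "Suc (card (\<Union>F))"]) (use bound le_imp_less_Suc in blast)
  then obtain xs where xs: "?path xs" and max: "\<And>zs. ?path zs \<Longrightarrow> length zs \<le> length xs"
    by blast
  then obtain x0 x1 rest where eq: "xs = x0 # x1 # rest"
    by (cases xs; cases "tl xs") auto
  have e01: "{x0, x1} \<in> F" using xs eq by simp
  have "edeg F x0 \<noteq> 0" using e01 fin by (auto simp: edeg_eq_0_iff)
  then have "card {e \<in> F. x0 \<in> e} = 2" using reg[of x0] by (simp add: edeg_def)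
  then obtain e where e: "e \<in> F" "x0 \<in> e" "e \<noteq> {x0, x1}"
    by (auto simp: card_2_iff)
  then obtain y where y: "e = {x0, y}" "y \<noteq> x0"
    using edges[OF e(1)] by (auto simp: card_2_iff doubleton_eq_iff)
  have "y \<in> set xs"
  proof (rule ccontr)
    assume "y \<notin> set xs"
    then have "?path (y # xs)" using xs eq e y by (auto simp: insert_commute)
    then show False using max by fastforce
  qed
  \<comment> \<open>The second edge misses \<open>x1\<close>, so its end lies at least two steps
    along the path and the cycle has length at least 3.\<close>
  then have "y \<in> set rest" using y e eq by auto
  then obtain p q where pq: "rest = p @ y # q" by (auto simp: in_set_conv_decomp)
  define ys where "ys = x0 # x1 # p @ [y]"
  have pre: "xs = ys @ q" by (simp add: ys_def eq pq)
  have "successively (\<lambda>a b. {a, b} \<in> F) ys" using xs pre by (simp add: successively_append_iff)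
  then have "{a, b} \<in> F" if "(a, b) \<in> set (zip ys (rotate1 ys))" for a b
    using that e y successively_imp_zip[of "\<lambda>a b. {a, b} \<in> F" x0 "x1 # p @ [y]" x0 a b]
    by (simp add: ys_def insert_commute)
  then have "edges_of (set (zip ys (rotate1 ys))) \<subseteq> F" by (auto simp: edges_of_def)
  moreover have "distinct ys" using xs pre by simp
  ultimately show ?thesis by (intro exI[of _ ys]) (auto simp: ys_def)
qed

lemma mem_edges_of_parcs:
  assumes "pair_graph G"
  shows "{a, b} \<in> edges_of (parcs G) \<longleftrightarrow> (a, b) \<in> parcs G"
proof -
  interpret pair_graph G by fact
  have "sym (parcs G)" using pair_sym_arcs by (simp add: symmetric_def)
  then have "(b, a) \<in> parcs G \<Longrightarrow> (a, b) \<in> parcs G" by (rule symD)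
  then show ?thesis by (force simp: edges_of_def doubleton_eq_iff)
qed

text \<open>Cycles are split off one at a time: a cycle uses up both edges at each of its vertices,
  so the remaining edges avoid it and again have degrees 0 or 2.\<close>

lemma two_regular_imp_cycle_packing:
  assumes G: "pair_graph G"
    and "F \<subseteq> edges_of (parcs G)" "\<And>v. edeg F v = 0 \<or> edeg F v = 2"
  shows "\<exists>\<C>. cycle_packing G \<C> \<and> (\<Union>C\<in>\<C>. cycle_verts C) = {v. edeg F v \<noteq> 0}"
  using assms(2,3)
proof (induction "card F" arbitrary: F rule: less_induct)
  case less
  interpret pair_graph G by (rule G)
  have fin: "finite F" by (rule finite_subset[OF less.prems(1)]) (simp add: edges_of_def pair_finite_arcs)
  have edges: "card e = 2" if "e \<in> F" for e
    using that less.prems(1) no_loops' by (fastforce simp: edges_of_def)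
  show ?case
  proof (cases "F = {}")
    case True
    then show ?thesis by (intro exI[of _ "{}"]) (auto simp: cycle_packing_def)
  next
    case False
    from ex_cycle_in_two_regular[OF fin edges less.prems(2) False] obtain ys
      where ys: "distinct ys" "3 \<le> length ys" and sub: "edges_of (set (zip ys (rotate1 ys))) \<subseteq> F"
      by auto
    define C where "C = zip ys (rotate1 ys)"
    define K where "K = edges_of (set C)"
    have KF: "K \<subseteq> F" using sub by (simp add: K_def C_def)
    have "(a, b) \<in> parcs G" if "(a, b) \<in> set C" for a b
    proof -
      have "{a, b} \<in> K" using that by (auto simp: K_def edges_of_def)
      then show ?thesis using KF less.prems(1) mem_edges_of_parcs[OF G] by blast
    qed
    then have "set C \<subseteq> parcs G" by auto
    then have cyc: "ugraph_cycle G C"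
      using cycle_zip_rotate1[OF G ys(1)] ys(2) by (force simp: ugraph_cycle_def C_def)
    have degK: "edeg K v = (if v \<in> cycle_verts C then 2 else 0)" for v
      unfolding K_def using ys by (intro edeg_cycle) (auto simp: C_def)
    have split: "edeg F v = edeg (F - K) v + edeg K v" for v
      using edeg_diff_Int[OF fin, of v K] KF by (simp add: Int_absorb1)
    have degFK: "edeg (F - K) v = (if v \<in> cycle_verts C then 0 else edeg F v)" for v
      using split[of v] degK[of v] less.prems(2)[of v] by (auto split: if_splits)
    have "K \<noteq> {}" using ys by (cases ys) (auto simp: K_def C_def edges_of_def)
    then have "card (F - K) < card F" using KF fin by (intro psubset_card_mono) auto
    from less.hyps[OF this] obtain \<C> where \<C>: "cycle_packing G \<C>"
      "(\<Union>D\<in>\<C>. cycle_verts D) = {v. edeg (F - K) v \<noteq> 0}"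
      using less.prems degFK by (metis Diff_subset subset_trans)
    have "cycle_verts D \<inter> cycle_verts C = {}" if "D \<in> \<C>" for D
    proof -
      have "cycle_verts D \<subseteq> {v. edeg (F - K) v \<noteq> 0}" using \<C>(2) that by blast
      then show ?thesis by (auto simp: degFK split: if_splits)
    qed
    then have "pairwise (\<lambda>C D. disjnt (cycle_verts C) (cycle_verts D)) (insert C \<C>)"
      using \<C>(1) unfolding cycle_packing_def pairwise_insert disjnt_def by (simp add: Int_commute)
    then have "cycle_packing G (insert C \<C>)"
      using \<C>(1) cyc unfolding cycle_packing_def by simp
    moreover have "edeg F v \<noteq> 0 \<longleftrightarrow> v \<in> cycle_verts C \<or> edeg (F - K) v \<noteq> 0" for v
      using split[of v] degK[of v] by auto
    with \<C>(2) have "(\<Union>D\<in>insert C \<C>. cycle_verts D) = {v. edeg F v \<noteq> 0}" by auto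
    ultimately show ?thesis by blast
  qed
qed

section \<open>Degree sums against cycle packings and transversals\<close>

theorem theorem1p3:
  fixes G :: "'a pair_pre_digraph" and S :: "'a set"
  assumes "pair_graph G" and "S \<subseteq> pverts G"
  shows "tau G S \<le> nu G S"
proof -
  interpret pair_graph G by fact
  let ?E = "edges_of (parcs G)"
  have fin: "finite ?E" using pair_finite_arcs by (simp add: edges_of_def)
  have edges: "card e = 2" if "e \<in> ?E" for e
    using that no_loops' by (fastforce simp: edges_of_def)
  have finS: "finite S" using assms(2) pair_finite_verts by (rule finite_subset)
  \<comment> \<open>With every vertex capacitated, an admissible edge set has degrees 0 or 2 and
    splits into a cycle packing; each covered vertex of \<open>S\<close> contributes 2, hence the
    factor.\<close>
  have bound: "sum (edeg F) S \<le> 2 * nu G S" if F: "F \<subseteq> ?E" "even_subgraph (pverts G) F" for F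
  proof -
    have "finite F" using F(1) fin finite_subset by blast
    then have "edeg F v = 0" if "v \<notin> pverts G" for v
      using that F(1) by (auto simp: edeg_eq_0_iff edges_of_def dest: in_arcsD1 in_arcsD2)
    then have reg: "edeg F v = 0 \<or> edeg F v = 2" for v
      using F(2) even_le_2 unfolding even_subgraph_def by metis
    from two_regular_imp_cycle_packing[OF assms(1) F(1) this] obtain \<C>
      where \<C>: "cycle_packing G \<C>" "(\<Union>C\<in>\<C>. cycle_verts C) = {v. edeg F v \<noteq> 0}" by auto
    have "sum (edeg F) S = (\<Sum>v\<in>S. if edeg F v \<noteq> 0 then 2 else 0)"
      by (rule sum.cong[OF refl]) (use reg in metis)
    also have "\<dots> = 2 * card (S \<inter> (\<Union>C\<in>\<C>. cycle_verts C))"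
      using finS by (simp add: \<C>(2) sum.If_cases Int_def)
    also have "card (S \<inter> (\<Union>C\<in>\<C>. cycle_verts C)) \<le> nu G S"
      unfolding nu_def using nu_set_finite_nonempty(1)[OF assms] \<C>(1) by (intro Max_ge) auto
    finally show ?thesis by simp
  qed
  from transversal_of_bounded_even_subgraphs[OF fin edges pair_finite_verts assms(2) bound]
  obtain X where X: "X \<subseteq> pverts G" "card X \<le> nu G S"
    "\<And>C s. C \<subseteq> ?E \<Longrightarrow> even_subgraph UNIV C \<Longrightarrow> (\<forall>x\<in>X. edeg C x = 0) \<Longrightarrow> s \<in> S \<Longrightarrow> edeg C s = 0"
    by auto
  have "X \<inter> cycle_verts C \<noteq> {}" if "S_cycle G S C" for C
  proof -
    have C: "pre_digraph.cycle (with_proj G) C" "3 \<le> length C" and "cycle_verts C \<inter> S \<noteq> {}"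
      using that by (auto simp: S_cycle_def ugraph_cycle_def)
    then obtain s where s: "s \<in> cycle_verts C" "s \<in> S" by auto
    note cyc = cycle_imp_rotate1[OF assms(1) C(1)]
    have deg: "edeg (edges_of (set C)) v = (if v \<in> cycle_verts C then 2 else 0)" for v
      by (rule edeg_cycle[OF cyc(1,2) C(2)])
    have "edges_of (set C) \<subseteq> ?E" using cyc(3) by (auto simp: edges_of_def)
    moreover have "even_subgraph UNIV (edges_of (set C))" by (simp add: even_subgraph_def deg)
    \<comment> \<open>The cycle has degree 2 at \<open>s\<close>, so by the choice of
      \<open>X\<close> it cannot have degree 0 throughout \<open>X\<close>.\<close>
    ultimately have "\<not> (\<forall>x\<in>X. edeg (edges_of (set C)) x = 0)"
      using X(3)[of "edges_of (set C)" s] s deg[of s] by fastforce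
    then show ?thesis using deg by (auto split: if_splits)
  qed
  then have "S_cycle_transversal G S X" using X(1) by (auto simp: S_cycle_transversal_def)
  then have "tau G S \<le> card X"
    unfolding tau_def using tau_set_finite_nonempty(1)[OF assms(1)] by (intro Min_le) auto
  then show ?thesis using X(2) by simp
qed

end
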